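(* Let $X$ be a $T_0$ space. Then the following conditions are equivalent: (1) $X$ is a continuous space; (2) the map $\bigvee:\mathrm{I}_T(X)\to X$, $A\mapsto\bigvee A$, has a continuous lower adjoint; (3) $X$ is a continuous retract of some algebraic space.
   Context: All topological spaces are $T_0$; order-theoretic notions on a space refer to the specialization order $x\sqsubseteq y$ iff $x\in\overline{\{y\}}$. A directed subset $D\subseteq X$ converges to $x$, written $D\to x$, if $D\cap U\neq\emptyset$ for every open neighbourhood $U$ of $x$. A subset $U\subseteq X$ is directed-open if for every directed $D\subseteq X$ and $x\in X$ with $D\to x$, $x\in U$ implies $D\cap U\ne\emptyset$. A directed space is a $T_0$ space in which every directed-open set is open. In a directed space, $x\ll y$ means that for every directed $D$ with $D\to y$ there is $d\in D$ with $x\sqsubseteq d$; $K(X)=\{x: x\ll x\}$. A continuous space is a directed space $X$ such that for each $x\in X$ there is a directed subset $D\subseteq\{y:y\ll x\}$ with $D\to x$. An algebraic space is a directed space such that for each $x\in X$, $\downarrow x\cap K(X)$ is directed and converges to $x$. A topological ideal of a $T_0$ space $X$ is a set of the form $\downarrow D$ where $D\subseteq X$ is directed and there is $x\in X$ with $D\to x$ and $d\sqsubseteq x$ for all $d\in D$. Each topological ideal $A$ has a supremum $\bigvee A$ and converges to it. $\mathrm{I}_T(X)$ is the set of all topological ideals of $X$, endowed with the topology $\Omega(\mathrm{I}_T(X))$ consisting of all $\mathcal{U}\subseteq\mathrm{I}_T(X)$ such that for all $A\in \mathrm{I}_T(X)$: $A\in\mathcal{U}$ iff there exists $x\in X$ with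 $\downarrow x\in\mathcal{U}$ and $\downarrow x\subseteq A$. Its specialization order is set inclusion. For monotone maps $f:P\to Q$, $g:Q\to P$ between posets, $f$ is the lower adjoint of $g$ if for all $x\in P$, $y\in Q$: $f(x)\le y\Leftrightarrow x\le g(y)$. $X$ is a continuous retract of $Y$ if there are continuous maps $f:Y\to X$ and $g:X\to Y$ with $f\circ g=\mathrm{id}_X$. *)

theory Defs
  imports "HOL-Analysis.Analysis"
begin

section \<open>Specialization order and directed convergence\<close>

definition spec_le :: "'a topology \<Rightarrow> 'a \<Rightarrow> 'a \<Rightarrow> bool" where
  "spec_le X x y \<longleftrightarrow> x \<in> X closure_of {y}"

definition down_set :: "'a topology \<Rightarrow> 'a set \<Rightarrow> 'a set" where
  "down_set X D = {y. \<exists>d\<in>D. spec_le X y d}"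

text \<open>Directed sets are nonempty, as usual.\<close>

definition directed_in :: "'a topology \<Rightarrow> 'a set \<Rightarrow> bool" where
  "directed_in X D \<longleftrightarrow>
     D \<subseteq> topspace X \<and> D \<noteq> {} \<and>
     (\<forall>a\<in>D. \<forall>b\<in>D. \<exists>c\<in>D. spec_le X a c \<and> spec_le X b c)"

definition converges_to :: "'a topology \<Rightarrow> 'a set \<Rightarrow> 'a \<Rightarrow> bool" where
  "converges_to X D x \<longleftrightarrow> (\<forall>U. openin X U \<and> x \<in> U \<longrightarrow> D \<inter> U \<noteq> {})"

definition is_lub_in :: "'a topology \<Rightarrow> 'a set \<Rightarrow> 'a \<Rightarrow> bool" where
  "is_lub_in X A s \<longleftrightarrow>
     s \<in> topspace X \<and> (\<forall>a\<in>A. spec_le X a s) \<and>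
     (\<forall>u\<in>topspace X. (\<forall>a\<in>A. spec_le X a u) \<longrightarrow> spec_le X s u)"

definition lub_in :: "'a topology \<Rightarrow> 'a set \<Rightarrow> 'a" where
  "lub_in X A = (THE s. is_lub_in X A s)"


section \<open>Directed, continuous and algebraic spaces\<close>

definition directed_open :: "'a topology \<Rightarrow> 'a set \<Rightarrow> bool" where
  "directed_open X U \<longleftrightarrow>
     U \<subseteq> topspace X \<and>
     (\<forall>D. \<forall>x\<in>topspace X. directed_in X D \<and> converges_to X D x \<and> x \<in> U \<longrightarrow> D \<inter> U \<noteq> {})"

definition directed_space :: "'a topology \<Rightarrow> bool" where
  "directed_space X \<longleftrightarrow> t0_space X \<and> (\<forall>U. directed_open X U \<longrightarrow> openin X U)"

definition way_below :: "'a topology \<Rightarrow> 'a \<Rightarrow> 'a \<Rightarrow> bool" where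
  "way_below X x y \<longleftrightarrow>
     x \<in> topspace X \<and> y \<in> topspace X \<and>
     (\<forall>D. directed_in X D \<and> converges_to X D y \<longrightarrow> (\<exists>d\<in>D. spec_le X x d))"

definition compact_points :: "'a topology \<Rightarrow> 'a set" where
  "compact_points X = {x \<in> topspace X. way_below X x x}"

definition continuous_space :: "'a topology \<Rightarrow> bool" where
  "continuous_space X \<longleftrightarrow>
     directed_space X \<and>
     (\<forall>x\<in>topspace X. \<exists>D. directed_in X D \<and> D \<subseteq> {y. way_below X y x} \<and> converges_to X D x)"

definition algebraic_space :: "'a topology \<Rightarrow> bool" where
  "algebraic_space X \<longleftrightarrow>
     directed_space X \<and>
     (\<forall>x\<in>topspace X.
        directed_in X (down_set X {x} \<inter> compact_points X) \<and>
        converges_to X (down_set X {x} \<inter> compact_points X) x)"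


section \<open>The space of topological ideals\<close>

definition topological_ideals :: "'a topology \<Rightarrow> 'a set set" where
  "topological_ideals X =
     {down_set X D | D. directed_in X D \<and>
        (\<exists>x\<in>topspace X. converges_to X D x \<and> (\<forall>d\<in>D. spec_le X d x))}"

definition ideal_open :: "'a topology \<Rightarrow> 'a set set \<Rightarrow> bool" where
  "ideal_open X \<U> \<longleftrightarrow>
     \<U> \<subseteq> topological_ideals X \<and>
     (\<forall>A\<in>topological_ideals X.
        A \<in> \<U> \<longleftrightarrow> (\<exists>x\<in>topspace X. down_set X {x} \<in> \<U> \<and> down_set X {x} \<subseteq> A))"

definition ideal_space :: "'a topology \<Rightarrow> 'a set topology" where
  "ideal_space X = topology (ideal_open X)"

lemma spec_le_topspace: "spec_le X x y \<Longrightarrow> x \<in> topspace X \<and> y \<in> topspace X"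
  by (auto simp: spec_le_def in_closure_of dest: openin_subset)

lemma spec_le_refl: "x \<in> topspace X \<Longrightarrow> spec_le X x x"
  by (auto simp: spec_le_def in_closure_of)

lemma spec_le_trans: "spec_le X x y \<Longrightarrow> spec_le X y z \<Longrightarrow> spec_le X x z"
  by (auto simp: spec_le_def in_closure_of)

lemma spec_le_antisym:
  "t0_space X \<Longrightarrow> spec_le X x y \<Longrightarrow> spec_le X y x \<Longrightarrow> x = y"
  unfolding t0_space_def spec_le_def in_closure_of by (metis singletonD)

lemma is_lub_in_unique:
  "t0_space X \<Longrightarrow> is_lub_in X A s \<Longrightarrow> is_lub_in X A t \<Longrightarrow> s = t"
  by (meson is_lub_in_def spec_le_antisym)

lemma lub_in_eqI: "t0_space X \<Longrightarrow> is_lub_in X A s \<Longrightarrow> lub_in X A = s"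
  unfolding lub_in_def by (rule the_equality) (auto intro: is_lub_in_unique)

lemma topological_ideal_has_lub:
  assumes "A \<in> topological_ideals X"
  obtains s where "is_lub_in X A s" "converges_to X A s"
proof -
  obtain D x where D: "A = down_set X D" "directed_in X D" "x \<in> topspace X"
      "converges_to X D x" "\<forall>d\<in>D. spec_le X d x"
    using assms unfolding topological_ideals_def by blast
  have sub: "D \<subseteq> A"
    using D(1,2) spec_le_refl[of _ X] unfolding down_set_def directed_in_def by fast
  have "spec_le X x u" if "u \<in> topspace X" "\<forall>a\<in>A. spec_le X a u" for u
    unfolding spec_le_def in_closure_of
  proof (intro conjI allI impI)
    fix T assume "x \<in> T \<and> openin X T"
    then obtain d where "d \<in> D" "d \<in> T" "openin X T"
      using D(4) unfolding converges_to_def by blast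
    then show "\<exists>y. y \<in> {u} \<and> y \<in> T"
      using that sub unfolding spec_le_def in_closure_of by blast
  qed (use D in auto)
  then have "is_lub_in X A x"
    unfolding is_lub_in_def using D(1,3,5) spec_le_trans[of X]
    unfolding down_set_def by blast
  moreover have "converges_to X A x"
    using D(4) sub unfolding converges_to_def by blast
  ultimately show thesis using that by blast
qed

lemma principal_ideal:
  assumes "x \<in> topspace X"
  shows "down_set X {x} \<in> topological_ideals X"
proof -
  have "directed_in X {x} \<and> converges_to X {x} x \<and> (\<forall>d\<in>{x}. spec_le X d x)"
    using assms spec_le_refl unfolding directed_in_def converges_to_def by fastforce
  then show ?thesis using assms unfolding topological_ideals_def by blast
qed

lemma principal_ideal_subset:
  "A \<in> topological_ideals X \<Longrightarrow> x \<in> topspace X \<Longrightarrow> down_set X {x} \<subseteq> A \<longleftrightarrow> x \<in> A"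
  using spec_le_refl[of x X] spec_le_trans[of X]
  unfolding topological_ideals_def down_set_def by blast

lemma topological_ideal_directed:
  assumes "A \<in> topological_ideals X"
  shows "directed_in X A"
proof -
  obtain D where D: "A = down_set X D" "directed_in X D"
    using assms unfolding topological_ideals_def by blast
  have 1: "A \<subseteq> topspace X" using D(1) spec_le_topspace[of X] unfolding down_set_def by blast
  have sub: "D \<subseteq> A"
    using D(1,2) spec_le_refl[of _ X] unfolding down_set_def directed_in_def by fast
  have "\<exists>c\<in>A. spec_le X a c \<and> spec_le X b c" if ab: "a \<in> A" "b \<in> A" for a b
  proof -
    obtain d e where de: "d \<in> D" "e \<in> D" "spec_le X a d" "spec_le X b e"
      using ab unfolding D(1) down_set_def by blast
    then obtain c where "c \<in> D" "spec_le X d c" "spec_le X e c"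
      using D(2) unfolding directed_in_def by blast
    then show ?thesis using de sub spec_le_trans[of X] by blast
  qed
  then show ?thesis using 1 sub D(2) unfolding directed_in_def by blast
qed

lemma istopology_ideal_open: "istopology (ideal_open X)"
  unfolding istopology_def
proof (intro conjI allI impI)
  fix S T assume S: "ideal_open X S" and T: "ideal_open X T"
  show "ideal_open X (S \<inter> T)"
    unfolding ideal_open_def
  proof (intro conjI ballI iffI)
    show "S \<inter> T \<subseteq> topological_ideals X" using S unfolding ideal_open_def by blast
  next
    fix A assume A: "A \<in> topological_ideals X" and "A \<in> S \<inter> T"
    then obtain x y where x: "x \<in> topspace X" "down_set X {x} \<in> S" "down_set X {x} \<subseteq> A"
      and y: "y \<in> topspace X" "down_set X {y} \<in> T" "down_set X {y} \<subseteq> A"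
      using S T unfolding ideal_open_def by blast
    then obtain z where z: "z \<in> A" "spec_le X x z" "spec_le X y z"
      using topological_ideal_directed[OF A] principal_ideal_subset[OF A]
      unfolding directed_in_def by blast
    then have zt: "z \<in> topspace X" using spec_le_topspace by fast
    have "down_set X {x} \<subseteq> down_set X {z}" "down_set X {y} \<subseteq> down_set X {z}"
      using z spec_le_trans[of X] unfolding down_set_def by blast+
    then have "down_set X {z} \<in> S" "down_set X {z} \<in> T"
      using S T x y principal_ideal[OF zt] unfolding ideal_open_def by blast+
    then show "\<exists>x\<in>topspace X. down_set X {x} \<in> S \<inter> T \<and> down_set X {x} \<subseteq> A"
      using z zt principal_ideal_subset[OF A zt] by blast
  next
    fix A assume "A \<in> topological_ideals X"
      "\<exists>x\<in>topspace X. down_set X {x} \<in> S \<inter> T \<and> down_set X {x} \<subseteq> A"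
    then show "A \<in> S \<inter> T" using S T unfolding ideal_open_def by blast
  qed
next
  fix K assume "\<forall>S\<in>K. ideal_open X S"
  then show "ideal_open X (\<Union>K)" unfolding ideal_open_def by blast
qed

lemma openin_ideal_space [simp]: "openin (ideal_space X) = ideal_open X"
  unfolding ideal_space_def by (rule topology_inverse'[OF istopology_ideal_open])

lemma topspace_ideal_space [simp]: "topspace (ideal_space X) = topological_ideals X"
proof (rule antisym)
  show "topspace (ideal_space X) \<subseteq> topological_ideals X"
    using openin_topspace[of "ideal_space X"] by (simp add: ideal_open_def)
  have "\<exists>x\<in>topspace X. down_set X {x} \<in> topological_ideals X \<and> down_set X {x} \<subseteq> A"
    if A: "A \<in> topological_ideals X" for A
  proof -
    obtain x where "x \<in> A" "x \<in> topspace X"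
      using topological_ideal_directed[OF A] unfolding directed_in_def by blast
    then show ?thesis using principal_ideal[of x X] principal_ideal_subset[OF A] by blast
  qed
  then have "ideal_open X (topological_ideals X)" unfolding ideal_open_def by blast
  then show "topological_ideals X \<subseteq> topspace (ideal_space X)"
    using openin_subset[of "ideal_space X"] by simp
qed

lemma spec_le_ideal_space:
  "spec_le (ideal_space X) A B \<longleftrightarrow>
     A \<in> topological_ideals X \<and> B \<in> topological_ideals X \<and> A \<subseteq> B"
proof (intro iffI conjI)
  assume *: "spec_le (ideal_space X) A B"
  then show AB: "A \<in> topological_ideals X" "B \<in> topological_ideals X"
    using spec_le_topspace[OF *] by auto
  show "A \<subseteq> B"
  proof
    fix x assume x: "x \<in> A"
    then have xt: "x \<in> topspace X"
      using topological_ideal_directed[OF AB(1)] unfolding directed_in_def by blast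
    have "down_set X {y} \<subseteq> C \<Longrightarrow> x \<in> down_set X {y} \<Longrightarrow> x \<in> C" for y C
      by blast
    moreover have "x \<in> down_set X {x}"
      using spec_le_refl[OF xt] unfolding down_set_def by simp
    ultimately have op: "ideal_open X {C \<in> topological_ideals X. x \<in> C}"
      unfolding ideal_open_def
      using xt principal_ideal[OF xt] principal_ideal_subset[OF _ xt] by blast
    have "\<forall>T. A \<in> T \<and> ideal_open X T \<longrightarrow> B \<in> T"
      using * unfolding spec_le_def in_closure_of by simp
    from this[rule_format, OF conjI[OF _ op]] show "x \<in> B" using x AB by simp
  qed
next
  assume AB: "A \<in> topological_ideals X \<and> B \<in> topological_ideals X \<and> A \<subseteq> B"
  have "B \<in> T" if T: "A \<in> T" "ideal_open X T" for T
  proof -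
    obtain x where "x \<in> topspace X" "down_set X {x} \<in> T" "down_set X {x} \<subseteq> A"
      using T AB unfolding ideal_open_def by blast
    then show ?thesis using T AB unfolding ideal_open_def by blast
  qed
  then show "spec_le (ideal_space X) A B"
    using AB unfolding spec_le_def in_closure_of by simp
qed


section \<open>Adjoints\<close>

text \<open>The two posets are the carriers of \<open>P\<close> and \<open>Q\<close> with their specialization orders.\<close>

definition lower_adjoint ::
  "'a topology \<Rightarrow> 'b topology \<Rightarrow> ('a \<Rightarrow> 'b) \<Rightarrow> ('b \<Rightarrow> 'a) \<Rightarrow> bool" where
  "lower_adjoint P Q f g \<longleftrightarrow>
     f \<in> topspace P \<rightarrow> topspace Q \<and> g \<in> topspace Q \<rightarrow> topspace P \<and>
     monotone_on (topspace P) (spec_le P) (spec_le Q) f \<and>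
     monotone_on (topspace Q) (spec_le Q) (spec_le P) g \<and>
     (\<forall>x\<in>topspace P. \<forall>y\<in>topspace Q. spec_le Q (f x) y \<longleftrightarrow> spec_le P x (g y))"

end

theory Submission
  imports Defs
begin

text \<open>
  In a continuous space the lower adjoint of \<open>A \<mapsto> \<Or>A\<close> is forced to be \<open>x \<mapsto> {y. y \<lless> x}\<close>,
  and its continuity amounts to saying that the sets \<open>{x. z \<lless> x}\<close> are open, which is the
  interpolation property (\<open>way_below_interpolation\<close>).  Conversely, a continuous lower adjoint \<open>f\<close>
  satisfies \<open>\<Or>(f x) = x\<close>, so \<open>f x\<close> is a directed set converging to \<open>x\<close>; pulling back along \<open>f\<close>
  the open family of ideals that meet a given upward closed set shows both that directed-open sets are
  open and that the members of \<open>f x\<close> lie way below \<open>x\<close>.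

  For the retracts, the space of topological ideals is algebraic for every \<open>X\<close>, its compact
  points being the principal ideals, and \<open>\<Or>\<close> is continuous on it.  A continuous lower adjoint is
  therefore a section exhibiting \<open>X\<close> as a retract of an algebraic space.  In the other direction,
  every algebraic space is continuous and continuity passes to retracts: a retraction \<open>r\<close> with
  section \<open>s\<close> sends points way below \<open>s x\<close> to points way below \<open>x\<close>.
\<close>

section \<open>Specialization order, directed sets and convergence\<close>

lemma spec_le_iff_open:
  "spec_le X x y \<longleftrightarrow>
     x \<in> topspace X \<and> y \<in> topspace X \<and> (\<forall>U. openin X U \<and> x \<in> U \<longrightarrow> y \<in> U)"
  unfolding spec_le_def in_closure_of by (auto dest: openin_subset)

lemma spec_le_continuous_image:
  assumes "continuous_map X Y f" "spec_le X x y"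
  shows "spec_le Y (f x) (f y)"
proof -
  have xy: "x \<in> topspace X" "y \<in> topspace X" using assms(2) spec_le_topspace by fast+
  have "f y \<in> U" if "openin Y U" "f x \<in> U" for U
  proof -
    have "openin X {z \<in> topspace X. f z \<in> U}"
      using assms(1) that(1) by (rule openin_continuous_map_preimage)
    then show ?thesis using assms(2) xy that(2) unfolding spec_le_iff_open by blast
  qed
  then show ?thesis
    using xy continuous_map_funspace[OF assms(1)] unfolding spec_le_iff_open by auto
qed

lemma directed_in_continuous_image:
  assumes "continuous_map X Y f" "directed_in X D"
  shows "directed_in Y (f ` D)"
proof -
  have "f ` D \<subseteq> topspace Y"
    using assms continuous_map_funspace[OF assms(1)] unfolding directed_in_def by blast
  moreover have "\<exists>c\<in>f ` D. spec_le Y a c \<and> spec_le Y b c" if "a \<in> f ` D" "b \<in> f ` D" for a b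
    using that assms(2) spec_le_continuous_image[OF assms(1)]
    unfolding directed_in_def by blast
  ultimately show ?thesis using assms(2) unfolding directed_in_def by blast
qed

lemma converges_to_continuous_image:
  assumes "continuous_map X Y f" "x \<in> topspace X" "converges_to X D x"
  shows "converges_to Y (f ` D) (f x)"
  unfolding converges_to_def
proof (intro allI impI)
  fix U assume U: "openin Y U \<and> f x \<in> U"
  then have "openin X {z \<in> topspace X. f z \<in> U}"
    using assms(1) openin_continuous_map_preimage by blast
  then have "D \<inter> {z \<in> topspace X. f z \<in> U} \<noteq> {}"
    using assms(2,3) U unfolding converges_to_def by blast
  then show "f ` D \<inter> U \<noteq> {}" by blast
qed

lemma directed_in_singleton: "x \<in> topspace X \<Longrightarrow> directed_in X {x}"
  unfolding directed_in_def using spec_le_refl by fastforce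

lemma converges_to_singleton_iff:
  assumes "x \<in> topspace X" "y \<in> topspace X"
  shows "converges_to X {y} x \<longleftrightarrow> spec_le X x y"
  using assms unfolding converges_to_def spec_le_iff_open by auto

lemma converges_to_below:
  "converges_to X D y \<Longrightarrow> spec_le X x y \<Longrightarrow> converges_to X D x"
  unfolding converges_to_def spec_le_iff_open by blast

lemma directed_open_upward:
  assumes "directed_open X U" "x \<in> U" "spec_le X x y"
  shows "y \<in> U"
proof -
  have xy: "x \<in> topspace X" "y \<in> topspace X" using assms(3) spec_le_topspace by fast+
  then have "directed_in X {y}" "converges_to X {y} x"
    using directed_in_singleton converges_to_singleton_iff assms(3) by fast+
  then have "{y} \<inter> U \<noteq> {}"
    using assms(1,2) xy unfolding directed_open_def by blast
  then show ?thesis by blast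
qed

section \<open>The way-below relation\<close>

lemma way_below_spec_le:
  assumes "way_below X x y"
  shows "spec_le X x y"
proof -
  have "y \<in> topspace X" using assms unfolding way_below_def by blast
  then have "directed_in X {y}" "converges_to X {y} y"
    using directed_in_singleton converges_to_singleton_iff spec_le_refl by fast+
  then show ?thesis using assms unfolding way_below_def by blast
qed

lemma way_below_mono:
  assumes "spec_le X w x" "way_below X x y" "spec_le X y z"
  shows "way_below X w z"
  using assms spec_le_topspace[OF assms(1)] spec_le_topspace[OF assms(3)]
    spec_le_trans[OF assms(1)] converges_to_below[OF _ assms(3)]
  unfolding way_below_def by meson

lemma way_below_set_eq_down_set:
  assumes "directed_in X D" "D \<subseteq> {y. way_below X y x}" "converges_to X D x"
  shows "{y. way_below X y x} = down_set X D"
proof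
  show "{y. way_below X y x} \<subseteq> down_set X D"
    using assms(1,3) unfolding way_below_def down_set_def by blast
  have "way_below X y x" if "d \<in> D" "spec_le X y d" for y d
    using that assms(2) way_below_mono[of X y d x x] spec_le_refl[of x X]
    unfolding way_below_def by blast
  then show "down_set X D \<subseteq> {y. way_below X y x}" unfolding down_set_def by blast
qed

lemma way_below_set_topological_ideal:
  assumes "continuous_space X" "x \<in> topspace X"
  shows "{y. way_below X y x} \<in> topological_ideals X"
proof -
  obtain D where D: "directed_in X D" "D \<subseteq> {y. way_below X y x}" "converges_to X D x"
    using assms unfolding continuous_space_def by blast
  then have "\<forall>d\<in>D. spec_le X d x" using way_below_spec_le by fast
  then show ?thesis
    using way_below_set_eq_down_set[OF D] D assms(2) unfolding topological_ideals_def by blast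
qed

lemma way_below_set_converges:
  assumes "continuous_space X" "x \<in> topspace X"
  shows "converges_to X {y. way_below X y x} x"
proof -
  obtain D where "D \<subseteq> {y. way_below X y x}" "converges_to X D x"
    using assms unfolding continuous_space_def by blast
  then show ?thesis unfolding converges_to_def by blast
qed

text \<open>
  The points way below some member of \<open>D\<close> again form a directed set converging to \<open>x\<close>, so a
  point way below \<open>x\<close> lies under one of them.
\<close>

lemma way_below_interpolation:
  assumes X: "continuous_space X" and D: "directed_in X D" "converges_to X D x"
    and z: "way_below X z x"
  shows "\<exists>d\<in>D. way_below X z d"
proof -
  define E where "E = (\<Union>d\<in>D. {y. way_below X y d})"
  have Dt: "D \<subseteq> topspace X" using D(1) unfolding directed_in_def by blast
  have dir: "directed_in X {y. way_below X y d}" if "d \<in> D" for d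
    using topological_ideal_directed[OF way_below_set_topological_ideal[OF X]] that Dt by blast
  have "directed_in X E"
    unfolding directed_in_def
  proof (intro conjI ballI)
    show "E \<subseteq> topspace X" unfolding E_def way_below_def by blast
    obtain d where d: "d \<in> D" using D(1) unfolding directed_in_def by blast
    then have "{y. way_below X y d} \<noteq> {}" using dir[OF d] unfolding directed_in_def by simp
    then show "E \<noteq> {}" using d unfolding E_def by blast
  next
    fix a b assume "a \<in> E" "b \<in> E"
    then obtain d e where de: "d \<in> D" "e \<in> D" "way_below X a d" "way_below X b e"
      unfolding E_def by blast
    then obtain c where c: "c \<in> D" "spec_le X d c" "spec_le X e c"
      using D(1) unfolding directed_in_def by blast
    have "spec_le X a a" "spec_le X b b"
      using de(3,4) spec_le_refl unfolding way_below_def by fast+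
    then have "way_below X a c" "way_below X b c"
      using de(3,4) c(2,3) way_below_mono by fast+
    then have "a \<in> {y. way_below X y c}" "b \<in> {y. way_below X y c}" by simp_all
    then obtain y where "y \<in> {y. way_below X y c}" "spec_le X a y" "spec_le X b y"
      using dir[OF c(1)] unfolding directed_in_def by meson
    then show "\<exists>y\<in>E. spec_le X a y \<and> spec_le X b y"
      using c(1) unfolding E_def by blast
  qed
  moreover have "converges_to X E x"
    unfolding converges_to_def
  proof (intro allI impI)
    fix U assume U: "openin X U \<and> x \<in> U"
    then obtain d where d: "d \<in> D" "d \<in> U" using D(2) unfolding converges_to_def by blast
    then have "{y. way_below X y d} \<inter> U \<noteq> {}"
      using U Dt way_below_set_converges[OF X, of d] unfolding converges_to_def by blast
    then show "E \<inter> U \<noteq> {}" using d(1) unfolding E_def by blast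
  qed
  ultimately obtain e where "e \<in> E" "spec_le X z e"
    using z unfolding way_below_def by blast
  moreover from this obtain d where "d \<in> D" "way_below X e d" unfolding E_def by blast
  moreover have "spec_le X d d" using \<open>d \<in> D\<close> Dt spec_le_refl by fast
  ultimately show ?thesis using way_below_mono by fast
qed

lemma openin_way_above:
  assumes "continuous_space X"
  shows "openin X {x. way_below X z x}"
proof -
  have "{x. way_below X z x} \<subseteq> topspace X" unfolding way_below_def by blast
  then have "directed_open X {x. way_below X z x}"
    using way_below_interpolation[OF assms] unfolding directed_open_def by blast
  then show ?thesis using assms unfolding continuous_space_def directed_space_def by blast
qed

section \<open>The space of topological ideals\<close>

lemma topological_ideal_downward:
  "A \<in> topological_ideals X \<Longrightarrow> y \<in> A \<Longrightarrow> spec_le X x y \<Longrightarrow> x \<in> A"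
  using spec_le_trans[of X] unfolding topological_ideals_def down_set_def by blast

lemma mem_down_set_self: "x \<in> topspace X \<Longrightarrow> x \<in> down_set X {x}"
  using spec_le_refl unfolding down_set_def by fast

lemma ideal_open_meets:
  assumes "\<And>x y. x \<in> U \<Longrightarrow> spec_le X x y \<Longrightarrow> y \<in> U"
  shows "ideal_open X {A \<in> topological_ideals X. A \<inter> U \<noteq> {}}"
proof -
  have "\<exists>x\<in>topspace X. down_set X {x} \<in> topological_ideals X \<and>
          down_set X {x} \<inter> U \<noteq> {} \<and> down_set X {x} \<subseteq> A"
    if A: "A \<in> topological_ideals X" "A \<inter> U \<noteq> {}" for A
  proof -
    obtain x where x: "x \<in> A" "x \<in> U" using A(2) by blast
    then have xt: "x \<in> topspace X"
      using topological_ideal_directed[OF A(1)] unfolding directed_in_def by blast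
    then show ?thesis
      using x principal_ideal[OF xt] principal_ideal_subset[OF A(1) xt] mem_down_set_self[OF xt]
      by blast
  qed
  then show ?thesis unfolding ideal_open_def by blast
qed

lemma ideal_open_contains:
  "ideal_open X {A \<in> topological_ideals X. x \<in> A}"
proof -
  have "{A \<in> topological_ideals X. x \<in> A}
      = {A \<in> topological_ideals X. A \<inter> {y. spec_le X x y} \<noteq> {}}"
    using topological_ideal_downward topological_ideal_directed spec_le_refl
    unfolding directed_in_def by fastforce
  moreover have "ideal_open X {A \<in> topological_ideals X. A \<inter> {y. spec_le X x y} \<noteq> {}}"
    by (rule ideal_open_meets) (auto intro: spec_le_trans)
  ultimately show ?thesis by simp
qed

lemma principal_ideals_directed:
  assumes "A \<in> topological_ideals X"
  shows "directed_in (ideal_space X) ((\<lambda>x. down_set X {x}) ` A)"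
proof -
  have A: "A \<subseteq> topspace X" "A \<noteq> {}"
    "\<forall>a\<in>A. \<forall>b\<in>A. \<exists>c\<in>A. spec_le X a c \<and> spec_le X b c"
    using topological_ideal_directed[OF assms] unfolding directed_in_def by blast+
  have mono: "spec_le (ideal_space X) (down_set X {a}) (down_set X {b})"
    if ab: "spec_le X a b" for a b
  proof -
    have "down_set X {a} \<subseteq> down_set X {b}"
      using spec_le_trans[OF _ ab] unfolding down_set_def by blast
    then show ?thesis
      using spec_le_topspace[OF ab] principal_ideal[of a X] principal_ideal[of b X]
      unfolding spec_le_ideal_space by simp
  qed
  show ?thesis
    unfolding directed_in_def topspace_ideal_space
  proof (intro conjI)
    show "(\<lambda>x. down_set X {x}) ` A \<subseteq> topological_ideals X"
      using A(1) principal_ideal[of _ X] by blast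
    show "(\<lambda>x. down_set X {x}) ` A \<noteq> {}" using A(2) by simp
    show "\<forall>P\<in>(\<lambda>x. down_set X {x}) ` A. \<forall>Q\<in>(\<lambda>x. down_set X {x}) ` A.
        \<exists>R\<in>(\<lambda>x. down_set X {x}) ` A. spec_le (ideal_space X) P R \<and> spec_le (ideal_space X) Q R"
      using A(3) mono by blast
  qed
qed

lemma principal_ideals_converge:
  assumes "A \<in> topological_ideals X"
  shows "converges_to (ideal_space X) ((\<lambda>x. down_set X {x}) ` A) A"
  unfolding converges_to_def openin_ideal_space
proof (intro allI impI)
  fix \<U> assume "ideal_open X \<U> \<and> A \<in> \<U>"
  then obtain x where "x \<in> topspace X" "down_set X {x} \<in> \<U>" "down_set X {x} \<subseteq> A"
    using assms unfolding ideal_open_def by blast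
  then show "(\<lambda>x. down_set X {x}) ` A \<inter> \<U> \<noteq> {}"
    using principal_ideal_subset[OF assms] by blast
qed

lemma t0_space_ideal_space: "t0_space (ideal_space X)"
proof -
  have "\<exists>\<U>. ideal_open X \<U> \<and> (A \<in> \<U>) \<noteq> (B \<in> \<U>)"
    if AB: "A \<in> topological_ideals X" "B \<in> topological_ideals X" "A \<noteq> B" for A B
  proof -
    obtain x where "(x \<in> A) \<noteq> (x \<in> B)" using AB(3) by blast
    then show ?thesis using ideal_open_contains[of X x] AB by blast
  qed
  then show ?thesis unfolding t0_space_def by (simp add: disjoint_iff) metis
qed

text \<open>
  A directed-open family of ideals satisfies the defining condition of the topology because every
  ideal \<open>A\<close> is the limit of the directed family of the principal ideals below it.
\<close>

lemma directed_space_ideal_space: "directed_space (ideal_space X)"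
proof -
  have "ideal_open X \<U>" if \<U>: "directed_open (ideal_space X) \<U>" for \<U>
    unfolding ideal_open_def
  proof (intro conjI ballI iffI)
    show "\<U> \<subseteq> topological_ideals X" using \<U> unfolding directed_open_def by simp
  next
    fix A assume A: "A \<in> topological_ideals X" "A \<in> \<U>"
    then have "(\<lambda>x. down_set X {x}) ` A \<inter> \<U> \<noteq> {}"
      using \<U> principal_ideals_directed[OF A(1)] principal_ideals_converge[OF A(1)]
      unfolding directed_open_def topspace_ideal_space by blast
    then obtain x where x: "x \<in> A" "down_set X {x} \<in> \<U>" by blast
    then have "x \<in> topspace X"
      using topological_ideal_directed[OF A(1)] unfolding directed_in_def by blast
    then show "\<exists>x\<in>topspace X. down_set X {x} \<in> \<U> \<and> down_set X {x} \<subseteq> A"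
      using x principal_ideal_subset[OF A(1)] by blast
  next
    fix A assume A: "A \<in> topological_ideals X"
      "\<exists>x\<in>topspace X. down_set X {x} \<in> \<U> \<and> down_set X {x} \<subseteq> A"
    then obtain x where x: "x \<in> topspace X" "down_set X {x} \<in> \<U>" "down_set X {x} \<subseteq> A"
      by blast
    then have "spec_le (ideal_space X) (down_set X {x}) A"
      using A(1) principal_ideal[OF x(1)] unfolding spec_le_ideal_space by simp
    then show "A \<in> \<U>" using directed_open_upward[OF \<U> x(2)] by blast
  qed
  then show ?thesis
    using t0_space_ideal_space unfolding directed_space_def by simp
qed

text \<open>
  Principal ideals are compact since the ideals containing \<open>x\<close> form an open set; a compact ideal
  is principal since it is the limit of the principal ideals below it.
\<close>

lemma compact_points_ideal_space:
  "compact_points (ideal_space X) = (\<lambda>x. down_set X {x}) ` topspace X"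
proof
  show "compact_points (ideal_space X) \<subseteq> (\<lambda>x. down_set X {x}) ` topspace X"
  proof
    fix A assume "A \<in> compact_points (ideal_space X)"
    then have A: "A \<in> topological_ideals X" "way_below (ideal_space X) A A"
      unfolding compact_points_def by auto
    then obtain x where x: "x \<in> A" "A \<subseteq> down_set X {x}"
      using principal_ideals_directed[OF A(1)] principal_ideals_converge[OF A(1)]
      unfolding way_below_def spec_le_ideal_space by blast
    then have xt: "x \<in> topspace X"
      using topological_ideal_directed[OF A(1)] unfolding directed_in_def by blast
    then have "A = down_set X {x}" using x principal_ideal_subset[OF A(1) xt] by blast
    then show "A \<in> (\<lambda>x. down_set X {x}) ` topspace X" using xt by blast
  qed
next
  show "(\<lambda>x. down_set X {x}) ` topspace X \<subseteq> compact_points (ideal_space X)"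
  proof (rule image_subsetI)
    fix x assume x: "x \<in> topspace X"
    have "\<exists>A\<in>\<D>. spec_le (ideal_space X) (down_set X {x}) A"
      if \<D>: "converges_to (ideal_space X) \<D> (down_set X {x})" for \<D>
    proof -
      have "down_set X {x} \<in> {A \<in> topological_ideals X. x \<in> A}"
        using principal_ideal[OF x] mem_down_set_self[OF x] by blast
      then obtain A where "A \<in> \<D>" "A \<in> topological_ideals X" "x \<in> A"
        using \<D> ideal_open_contains[of X x] unfolding converges_to_def openin_ideal_space by blast
      then show ?thesis
        using principal_ideal[OF x] principal_ideal_subset[OF _ x]
        unfolding spec_le_ideal_space by blast
    qed
    then show "down_set X {x} \<in> compact_points (ideal_space X)"
      using principal_ideal[OF x] unfolding compact_points_def way_below_def by simp
  qed
qed

lemma algebraic_space_ideal_space: "algebraic_space (ideal_space X)"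
proof -
  have "down_set (ideal_space X) {A} \<inter> compact_points (ideal_space X)
      = (\<lambda>x. down_set X {x}) ` A" if A: "A \<in> topological_ideals X" for A
  proof -
    have "A \<subseteq> topspace X"
      using topological_ideal_directed[OF A] unfolding directed_in_def by blast
    then show ?thesis
      unfolding compact_points_ideal_space down_set_def[of "ideal_space X"] spec_le_ideal_space
      using A principal_ideal[of _ X] principal_ideal_subset[OF A] by blast
  qed
  then show ?thesis
    using directed_space_ideal_space[of X] principal_ideals_directed[of _ X]
      principal_ideals_converge[of _ X]
    unfolding algebraic_space_def topspace_ideal_space by auto
qed

section \<open>Suprema of topological ideals\<close>

context
  fixes X :: "'a topology"
  assumes t0: "t0_space X"
begin

lemma lub_in_topological_ideal:
  assumes "A \<in> topological_ideals X"
  shows "is_lub_in X A (lub_in X A)" "converges_to X A (lub_in X A)"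
  using topological_ideal_has_lub[OF assms] lub_in_eqI[OF t0] by metis+

lemma lub_in_principal:
  assumes "x \<in> topspace X"
  shows "lub_in X (down_set X {x}) = x"
proof -
  have "is_lub_in X (down_set X {x}) x"
    using assms mem_down_set_self[OF assms] unfolding is_lub_in_def down_set_def by blast
  then show ?thesis by (rule lub_in_eqI[OF t0])
qed

lemma lub_in_mem_open_iff:
  assumes "A \<in> topological_ideals X" "openin X U"
  shows "lub_in X A \<in> U \<longleftrightarrow> A \<inter> U \<noteq> {}"
  using lub_in_topological_ideal[OF assms(1)] assms(2)
  unfolding is_lub_in_def converges_to_def spec_le_iff_open by blast

lemma continuous_map_lub_in: "continuous_map (ideal_space X) X (lub_in X)"
  unfolding continuous_map_def topspace_ideal_space openin_ideal_space
proof (intro conjI allI impI)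
  show "lub_in X \<in> topological_ideals X \<rightarrow> topspace X"
    using lub_in_topological_ideal(1) unfolding is_lub_in_def by blast
next
  fix U assume U: "openin X U"
  have "{A \<in> topological_ideals X. lub_in X A \<in> U} = {A \<in> topological_ideals X. A \<inter> U \<noteq> {}}"
    using lub_in_mem_open_iff[OF _ U] by blast
  moreover have "ideal_open X {A \<in> topological_ideals X. A \<inter> U \<noteq> {}}"
    by (rule ideal_open_meets) (use U in \<open>auto simp: spec_le_iff_open\<close>)
  ultimately show "ideal_open X {A \<in> topological_ideals X. lub_in X A \<in> U}" by simp
qed

section \<open>Continuous spaces and the lower adjoint of the supremum map\<close>

lemma way_below_set_continuous_map:
  assumes X: "continuous_space X"
  shows "continuous_map X (ideal_space X) (\<lambda>x. {y. way_below X y x})"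
  unfolding continuous_map_def topspace_ideal_space openin_ideal_space
proof (intro conjI allI impI)
  show "(\<lambda>x. {y. way_below X y x}) \<in> topspace X \<rightarrow> topological_ideals X"
    using way_below_set_topological_ideal[OF X] by blast
next
  fix \<U> assume \<U>: "ideal_open X \<U>"
  have "{x \<in> topspace X. {y. way_below X y x} \<in> \<U>}
      = (\<Union>z\<in>{z \<in> topspace X. down_set X {z} \<in> \<U>}. {x. way_below X z x})"
  proof (intro equalityI subsetI)
    fix x assume "x \<in> {x \<in> topspace X. {y. way_below X y x} \<in> \<U>}"
    then have x: "x \<in> topspace X" "{y. way_below X y x} \<in> \<U>" by auto
    note id = way_below_set_topological_ideal[OF X x(1)]
    obtain z where "z \<in> topspace X" "down_set X {z} \<in> \<U>" "down_set X {z} \<subseteq> {y. way_below X y x}"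
      using \<U> id x(2) unfolding ideal_open_def by meson
    then show "x \<in> (\<Union>z\<in>{z \<in> topspace X. down_set X {z} \<in> \<U>}. {x. way_below X z x})"
      using principal_ideal_subset[OF id] by blast
  next
    fix x assume "x \<in> (\<Union>z\<in>{z \<in> topspace X. down_set X {z} \<in> \<U>}. {x. way_below X z x})"
    then obtain z where z: "z \<in> topspace X" "down_set X {z} \<in> \<U>" "way_below X z x" by blast
    then have x: "x \<in> topspace X" unfolding way_below_def by blast
    note id = way_below_set_topological_ideal[OF X x]
    have "down_set X {z} \<subseteq> {y. way_below X y x}"
      using principal_ideal_subset[OF id z(1)] z(3) by blast
    then have "{y. way_below X y x} \<in> \<U>" using \<U> id z(1,2) unfolding ideal_open_def by meson
    then show "x \<in> {x \<in> topspace X. {y. way_below X y x} \<in> \<U>}" using x by blast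
  qed
  then show "openin X {x \<in> topspace X. {y. way_below X y x} \<in> \<U>}"
    using openin_way_above[OF X] by auto
qed

lemma way_below_set_lower_adjoint:
  assumes X: "continuous_space X"
  shows "lower_adjoint X (ideal_space X) (\<lambda>x. {y. way_below X y x}) (lub_in X)"
proof -
  let ?f = "\<lambda>x. {y. way_below X y x}"
  have adj: "spec_le (ideal_space X) (?f x) A \<longleftrightarrow> spec_le X x (lub_in X A)"
    if x: "x \<in> topspace X" and A: "A \<in> topological_ideals X" for x A
  proof
    assume "spec_le (ideal_space X) (?f x) A"
    then have sub: "?f x \<subseteq> A" unfolding spec_le_ideal_space by blast
    have "lub_in X A \<in> U" if "openin X U" "x \<in> U" for U
      using that sub way_below_set_converges[OF X x] lub_in_mem_open_iff[OF A]
      unfolding converges_to_def by blast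
    then show "spec_le X x (lub_in X A)"
      using x lub_in_topological_ideal(1)[OF A] unfolding spec_le_iff_open is_lub_in_def by blast
  next
    assume "spec_le X x (lub_in X A)"
    then have "converges_to X A x"
      using converges_to_below lub_in_topological_ideal(2)[OF A] by fast
    then have "?f x \<subseteq> A"
      using topological_ideal_directed[OF A] topological_ideal_downward[OF A]
      unfolding way_below_def by blast
    then show "spec_le (ideal_space X) (?f x) A"
      using A way_below_set_topological_ideal[OF X x] unfolding spec_le_ideal_space by blast
  qed
  then show ?thesis
    using continuous_map_funspace[OF continuous_map_lub_in]
      continuous_map_funspace[OF way_below_set_continuous_map[OF X]]
      spec_le_continuous_image[OF continuous_map_lub_in]
      spec_le_continuous_image[OF way_below_set_continuous_map[OF X]]
    unfolding lower_adjoint_def by (auto intro!: monotone_onI)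
qed

text \<open>
  The adjunction applied to \<open>\<down>x\<close>, whose supremum is \<open>x\<close>, gives \<open>f x \<subseteq> \<down>x\<close>; applied to \<open>f x\<close>
  itself it gives \<open>x \<sqsubseteq> \<Or>(f x)\<close>.
\<close>

lemma lower_adjoint_bounds:
  assumes f: "lower_adjoint X (ideal_space X) f (lub_in X)" and x: "x \<in> topspace X"
  shows "f x \<in> topological_ideals X" "f x \<subseteq> down_set X {x}" "lub_in X (f x) = x"
proof -
  have adj: "\<And>A. A \<in> topological_ideals X \<Longrightarrow>
      spec_le (ideal_space X) (f x) A \<longleftrightarrow> spec_le X x (lub_in X A)"
    and mono: "monotone_on (topological_ideals X) (spec_le (ideal_space X)) (spec_le X) (lub_in X)"
    using f x unfolding lower_adjoint_def by simp_all
  show id: "f x \<in> topological_ideals X"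
    using f x unfolding lower_adjoint_def by auto
  have le: "spec_le (ideal_space X) (f x) (down_set X {x})"
    using adj[OF principal_ideal[OF x]] lub_in_principal[OF x] spec_le_refl[OF x] by simp
  then show "f x \<subseteq> down_set X {x}" unfolding spec_le_ideal_space by blast
  have "spec_le X (lub_in X (f x)) x"
    using monotone_onD[OF mono id principal_ideal[OF x] le] lub_in_principal[OF x] by simp
  moreover have "spec_le X x (lub_in X (f x))"
    using adj[OF id] id unfolding spec_le_ideal_space by blast
  ultimately show "lub_in X (f x) = x" using spec_le_antisym[OF t0] by blast
qed

lemma continuous_space_if_continuous_lower_adjoint:
  assumes cont: "continuous_map X (ideal_space X) f"
    and adj: "lower_adjoint X (ideal_space X) f (lub_in X)"
  shows "continuous_space X"
proof -
  note bounds = lower_adjoint_bounds[OF adj]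
  have conv: "converges_to X (f x) x" and dir: "directed_in X (f x)" if "x \<in> topspace X" for x
    using bounds[OF that] lub_in_topological_ideal(2)[of "f x"] topological_ideal_directed by auto
  have pre: "openin X {x \<in> topspace X. f x \<in> \<U>}" if "ideal_open X \<U>" for \<U>
    using openin_continuous_map_preimage[OF cont] that by simp
  have "openin X U" if U: "directed_open X U" for U
  proof -
    have meets: "ideal_open X {A \<in> topological_ideals X. A \<inter> U \<noteq> {}}"
      by (rule ideal_open_meets) (rule directed_open_upward[OF U])
    have "{x \<in> topspace X. f x \<in> {A \<in> topological_ideals X. A \<inter> U \<noteq> {}}} = U"
      (is "?L = _")
    proof
      show "U \<subseteq> ?L" using U conv dir bounds(1) unfolding directed_open_def by blast
      show "?L \<subseteq> U" using bounds(2) directed_open_upward[OF U] unfolding down_set_def by blast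
    qed
    then show ?thesis using pre[OF meets] by (rule subst)
  qed
  moreover have "way_below X y x" if x: "x \<in> topspace X" and y: "y \<in> f x" for x y
  proof -
    have "\<exists>d\<in>D. spec_le X y d" if D: "directed_in X D" "converges_to X D x" for D
    proof -
      \<comment> \<open>\<open>D\<close> need not lie below \<open>x\<close>, so the adjunction does not apply to \<open>\<down>D\<close>; continuity of \<open>f\<close>
          transports the convergence instead.\<close>
      have "openin X {z \<in> topspace X. f z \<in> {A \<in> topological_ideals X. y \<in> A}}"
        by (rule pre[OF ideal_open_contains])
      moreover have "x \<in> {z \<in> topspace X. f z \<in> {A \<in> topological_ideals X. y \<in> A}}"
        using x y bounds(1) by blast
      ultimately obtain d where "d \<in> D" "d \<in> topspace X" "y \<in> f d"
        using D(2) unfolding converges_to_def by blast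
      then show ?thesis using bounds(2) unfolding down_set_def by blast
    qed
    moreover have "y \<in> topspace X" using dir[OF x] y unfolding directed_in_def by blast
    ultimately show ?thesis using x unfolding way_below_def by blast
  qed
  ultimately show ?thesis
    using t0 conv dir unfolding continuous_space_def directed_space_def by blast
qed

end

section \<open>Retracts of continuous spaces\<close>

lemma continuous_space_if_algebraic_space:
  assumes "algebraic_space Y"
  shows "continuous_space Y"
proof -
  have "down_set Y {y} \<inter> compact_points Y \<subseteq> {x. way_below Y x y}" for y
    using way_below_mono[of Y] spec_le_refl[of _ Y]
    unfolding down_set_def compact_points_def by blast
  then show ?thesis using assms unfolding algebraic_space_def continuous_space_def by blast
qed

text \<open>
  For a section \<open>s\<close> of \<open>r\<close>, a directed set converging to \<open>x\<close> is mapped by \<open>s\<close> to one converging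
  to \<open>s x\<close>, some member of which lies above a given \<open>d \<lless> s x\<close>; applying \<open>r\<close> returns to the
  original set.
\<close>

lemma way_below_retraction:
  assumes "continuous_map Y X r" "continuous_map X Y s"
    and rs: "\<And>x. x \<in> topspace X \<Longrightarrow> r (s x) = x"
    and x: "x \<in> topspace X" and d: "way_below Y d (s x)"
  shows "way_below X (r d) x"
proof -
  have "\<exists>e\<in>E. spec_le X (r d) e" if E: "directed_in X E" "converges_to X E x" for E
  proof -
    have "directed_in Y (s ` E)" "converges_to Y (s ` E) (s x)"
      using E assms(2) x directed_in_continuous_image converges_to_continuous_image by fast+
    then obtain e where e: "e \<in> E" "spec_le Y d (s e)"
      using d unfolding way_below_def by blast
    then have "spec_le X (r d) (r (s e))"
      using assms(1) spec_le_continuous_image by fast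
    moreover have "r (s e) = e" using rs e(1) E(1) unfolding directed_in_def by blast
    ultimately show ?thesis using e(1) by auto
  qed
  moreover have "r d \<in> topspace X"
    using d continuous_map_funspace[OF assms(1)] unfolding way_below_def by blast
  ultimately show ?thesis using x unfolding way_below_def by blast
qed

lemma continuous_space_retract:
  assumes t0: "t0_space X" and Y: "continuous_space Y" and "retraction_map Y X r"
  shows "continuous_space X"
proof -
  obtain s where r: "continuous_map Y X r" and s: "continuous_map X Y s"
    and rs: "\<And>x. x \<in> topspace X \<Longrightarrow> r (s x) = x"
    using assms(3) unfolding retraction_map_def retraction_maps_def by blast
  have st: "s x \<in> topspace Y" if "x \<in> topspace X" for x
    using that continuous_map_funspace[OF s] by blast
  have rt: "r y \<in> topspace X" if "y \<in> topspace Y" for y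
    using that continuous_map_funspace[OF r] by blast
  have "openin X U" if U: "directed_open X U" for U
  proof -
    have "D \<inter> {y \<in> topspace Y. r y \<in> U} \<noteq> {}"
      if D: "directed_in Y D" "converges_to Y D y" and y: "y \<in> topspace Y" "r y \<in> U" for D y
    proof -
      have "directed_in X (r ` D)" "converges_to X (r ` D) (r y)"
        using D r y(1) directed_in_continuous_image converges_to_continuous_image by fast+
      then have "r ` D \<inter> U \<noteq> {}" using U y rt unfolding directed_open_def by blast
      then show ?thesis using D(1) unfolding directed_in_def by blast
    qed
    then have "directed_open Y {y \<in> topspace Y. r y \<in> U}"
      unfolding directed_open_def by blast
    then have "openin Y {y \<in> topspace Y. r y \<in> U}"
      using Y unfolding continuous_space_def directed_space_def by blast
    then have "openin X {x \<in> topspace X. s x \<in> {y \<in> topspace Y. r y \<in> U}}"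
      by (rule openin_continuous_map_preimage[OF s])
    moreover have "{x \<in> topspace X. s x \<in> {y \<in> topspace Y. r y \<in> U}} = U"
      using U rs st unfolding directed_open_def by auto
    ultimately show ?thesis by simp
  qed
  moreover have "\<exists>D. directed_in X D \<and> D \<subseteq> {y. way_below X y x} \<and> converges_to X D x"
    if x: "x \<in> topspace X" for x
  proof -
    obtain D where D: "directed_in Y D" "D \<subseteq> {y. way_below Y y (s x)}" "converges_to Y D (s x)"
      using Y st[OF x] unfolding continuous_space_def by blast
    have "directed_in X (r ` D)" using r D(1) by (rule directed_in_continuous_image)
    moreover have "r ` D \<subseteq> {y. way_below X y x}"
      using D(2) way_below_retraction[OF r s rs x] by blast
    moreover have "converges_to X (r ` D) x"
      using converges_to_continuous_image[OF r st[OF x] D(3)] rs[OF x] by simp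
    ultimately show ?thesis by blast
  qed
  ultimately show ?thesis
    using t0 unfolding continuous_space_def directed_space_def by blast
qed

section \<open>Characterizations of continuous spaces\<close>

theorem theorem4p8:
  fixes X :: "'a topology"
  assumes "t0_space X"
  shows "(continuous_space X \<longleftrightarrow>
            (\<exists>f. continuous_map X (ideal_space X) f \<and>
                 lower_adjoint X (ideal_space X) f (lub_in X)))
       \<and> (continuous_space X \<longleftrightarrow>
            (\<exists>Y :: 'a set topology. algebraic_space Y \<and> (\<exists>r. retraction_map Y X r)))
       \<and> (\<forall>Y :: 'b topology. algebraic_space Y \<and> (\<exists>r. retraction_map Y X r) \<longrightarrow>
            continuous_space X)"
proof (intro conjI)
  let ?f = "\<lambda>x. {y. way_below X y x}"
  show "continuous_space X \<longleftrightarrow>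
      (\<exists>f. continuous_map X (ideal_space X) f \<and> lower_adjoint X (ideal_space X) f (lub_in X))"
    using way_below_set_continuous_map[OF assms] way_below_set_lower_adjoint[OF assms]
      continuous_space_if_continuous_lower_adjoint[OF assms] by blast
  have "retraction_map (ideal_space X) X (lub_in X)" if X: "continuous_space X"
  proof -
    have "retraction_maps (ideal_space X) X (lub_in X) ?f"
      unfolding retraction_maps_def
      using continuous_map_lub_in[OF assms] way_below_set_continuous_map[OF assms X]
        lower_adjoint_bounds(3)[OF assms way_below_set_lower_adjoint[OF assms X]] by blast
    then show ?thesis unfolding retraction_map_def by blast
  qed
  then show "continuous_space X \<longleftrightarrow>
      (\<exists>Y :: 'a set topology. algebraic_space Y \<and> (\<exists>r. retraction_map Y X r))"
    using algebraic_space_ideal_space[of X] continuous_space_if_algebraic_space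
      continuous_space_retract[OF assms] by metis
  show "\<forall>Y :: 'b topology. algebraic_space Y \<and> (\<exists>r. retraction_map Y X r) \<longrightarrow>
      continuous_space X"
    using continuous_space_if_algebraic_space continuous_space_retract[OF assms] by blast
qed

end
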